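(* The bicyclic monoid $\mathcal{B}$ and the monoid $UT_2(\mathbb{T})$ of $2\times 2$ upper triangular tropical matrices satisfy exactly the same semigroup identities.
   Context: The tropical semiring $\mathbb{T}$ is the set $\mathbb{R}\cup\{-\infty\}$ with operations $a\oplus b=\max(a,b)$ and $a\otimes b=a+b$, where $-\infty\oplus a=a$ and $-\infty\otimes a=-\infty$ for all $a\in\mathbb{T}$. $UT_2(\mathbb{T})$ is the monoid of all $2\times 2$ matrices over $\mathbb{T}$ whose entry below the main diagonal is $-\infty$, under the matrix multiplication induced by $\oplus$ and $\otimes$. The bicyclic monoid is $\mathcal{B}=\langle p,q\mid pq=1\rangle$ (monoid presentation). A semigroup identity is a pair of words, written $u=v$, with $u,v$ in the free semigroup $\Sigma^+$ on a finite alphabet $\Sigma$. It is satisfied by (holds in) a semigroup $S$ if every semigroup morphism $\Sigma^+\to S$ maps $u$ and $v$ to the same element of $S$. *)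

theory Defs
  imports "HOL-Analysis.Cartesian_Space" "HOL-Algebra.Group"
begin

text \<open>
  The tropical semiring. Through the class operations, \<open>+\<close> is the tropical sum (maximum) and \<open>*\<close>
  the tropical product (addition of reals), so that \<open>0 = NegInf\<close> and \<open>1 = Fin 0\<close>.
\<close>

datatype trop = NegInf | Fin real

instantiation trop :: comm_semiring_1
begin

definition zero_trop :: trop where "0 = NegInf"

definition one_trop :: trop where "1 = Fin 0"

fun plus_trop :: "trop \<Rightarrow> trop \<Rightarrow> trop" where
  "plus_trop NegInf b = b"
| "plus_trop a NegInf = a"
| "plus_trop (Fin x) (Fin y) = Fin (max x y)"

fun times_trop :: "trop \<Rightarrow> trop \<Rightarrow> trop" where
  "times_trop NegInf b = NegInf"
| "times_trop a NegInf = NegInf"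
| "times_trop (Fin x) (Fin y) = Fin (x + y)"

instance
proof
  fix a b c :: trop
  show "a + b + c = a + (b + c)"
    by (cases a; cases b; cases c) (auto simp: max.assoc)
  show "a + b = b + a"
    by (cases a; cases b) (auto simp: max.commute)
  show "0 + a = a"
    by (simp add: zero_trop_def)
  show "a * b * c = a * (b * c)"
    by (cases a; cases b; cases c) auto
  show "a * b = b * a"
    by (cases a; cases b) auto
  show "1 * a = a"
    by (cases a) (auto simp: one_trop_def)
  show "(a + b) * c = a * c + b * c"
    by (cases a; cases b; cases c) (auto simp: max_def)
  show "0 * a = 0" and "a * 0 = 0"
    by (cases a; simp add: zero_trop_def)+
  show "(0 :: trop) \<noteq> 1"
    by (simp add: zero_trop_def one_trop_def)
qed

end

definition UT2 :: "(trop ^ 2 ^ 2) monoid" where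
  "UT2 = \<lparr>carrier = {A. A $ 2 $ 1 = NegInf}, mult = (**), one = mat 1\<rparr>"

lemma monoid_UT2: "monoid UT2"
proof -
  have "(A ** B) $ 2 $ 1 = 0" if "A $ 2 $ 1 = 0" "B $ 2 $ 1 = 0" for A B :: "trop ^ 2 ^ 2"
    using that by (simp add: matrix_matrix_mult_def sum_2)
  moreover have "(mat 1 :: trop ^ 2 ^ 2) $ 2 $ 1 = 0"
    by (simp add: mat_def)
  ultimately show ?thesis
    by unfold_locales (auto simp: UT2_def matrix_mul_assoc simp flip: zero_trop_def)
qed

text \<open>
  The monoid presented by the set \<open>UNIV\<close> of generators of type \<open>'a\<close> and the set \<open>R\<close> of relations:
  the free monoid of words modulo the least congruence containing \<open>R\<close>.
\<close>

inductive_set congruence_gen :: "('a list \<times> 'a list) set \<Rightarrow> ('a list \<times> 'a list) set"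
  for R where
  base: "(u, v) \<in> R \<Longrightarrow> (u, v) \<in> congruence_gen R"
| refl: "(u, u) \<in> congruence_gen R"
| sym: "(u, v) \<in> congruence_gen R \<Longrightarrow> (v, u) \<in> congruence_gen R"
| trans: "(u, v) \<in> congruence_gen R \<Longrightarrow> (v, w) \<in> congruence_gen R
    \<Longrightarrow> (u, w) \<in> congruence_gen R"
| append: "(u, v) \<in> congruence_gen R \<Longrightarrow> (u', v') \<in> congruence_gen R
    \<Longrightarrow> (u @ u', v @ v') \<in> congruence_gen R"

definition presented_monoid :: "('a list \<times> 'a list) set \<Rightarrow> 'a list set monoid" where
  "presented_monoid R =
     \<lparr>carrier = UNIV // congruence_gen R,
      mult = (\<lambda>X Y. \<Union>x\<in>X. \<Union>y\<in>Y. congruence_gen R `` {x @ y}),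
      one = congruence_gen R `` {[]}\<rparr>"

lemma equiv_congruence_gen: "equiv UNIV (congruence_gen R)"
  by (intro equivI refl_onI symI transI)
     (auto intro: congruence_gen.refl congruence_gen.sym congruence_gen.trans)

lemma presented_monoid_mult_class:
  "(congruence_gen R `` {x}) \<otimes>\<^bsub>presented_monoid R\<^esub> (congruence_gen R `` {y})
     = congruence_gen R `` {x @ y}"
proof -
  have "(\<lambda>x y. congruence_gen R `` {x @ y}) respects2 congruence_gen R"
    by (intro congruent2I') (auto intro!: equiv_class_eq[OF equiv_congruence_gen] congruence_gen.append)
  then show ?thesis
    by (simp add: presented_monoid_def UN_equiv_class2[OF equiv_congruence_gen equiv_congruence_gen])
qed

lemma monoid_presented_monoid: "monoid (presented_monoid R)"
proof -
  let ?M = "presented_monoid R"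
  have carrier: "carrier ?M = range (\<lambda>x. congruence_gen R `` {x})"
    by (auto simp: presented_monoid_def quotient_def)
  have one: "\<one>\<^bsub>?M\<^esub> = congruence_gen R `` {[]}"
    by (simp add: presented_monoid_def)
  show ?thesis
    by unfold_locales (auto simp: carrier one presented_monoid_mult_class)
qed

datatype bicyclic_gen = P | Q

definition bicyclic :: "bicyclic_gen list set monoid" where
  "bicyclic = presented_monoid {([P, Q], [])}"


text \<open>
  The free semigroup of nonempty words over the alphabet \<open>\<Sigma>\<close>. The unit field of the record carries
  no information: the empty word lies outside the carrier, and \<^const>\<open>hom\<close> only constrains the
  multiplication, so its members are precisely the semigroup morphisms.
\<close>

definition free_semigroup :: "'x set \<Rightarrow> 'x list monoid" where
  "free_semigroup \<Sigma> = \<lparr>carrier = lists \<Sigma> - {[]}, mult = (@), one = []\<rparr>"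

definition satisfies_identity :: "('a, 'b) monoid_scheme \<Rightarrow> 'x set \<Rightarrow> 'x list \<Rightarrow> 'x list \<Rightarrow> bool" where
  "satisfies_identity S \<Sigma> u v \<longleftrightarrow> (\<forall>\<phi> \<in> hom (free_semigroup \<Sigma>) S. \<phi> u = \<phi> v)"

end

theory Submission
  imports Defs "HOL-Library.Multiset"
begin

text \<open>
  Sending \<open>q\<^sup>i p\<^sup>j\<close> to the matrix with rows \<open>(i - j, i)\<close> and \<open>(-\<infinity>, 0)\<close> embeds the bicyclic monoid as
  a semigroup into \<open>UT\<^sub>2(\<T>)\<close>, so identities of the latter hold in the former. Conversely, the
  \<open>(1, 2)\<close> entry of a product of triangular matrices along a word \<open>w\<close> is the maximum over the
  positions \<open>t\<close> of \<open>a(w\<^sub>1 \<dots> w\<^sub>t\<^sub>-\<^sub>1) + c(w\<^sub>t) + b(w\<^sub>t\<^sub>+\<^sub>1 \<dots> w\<^sub>n)\<close>. An identity \<open>u = v\<close> of the bicyclic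
  monoid preserves the number of occurrences of each letter, so only the weight \<open>d = a - b\<close> of
  prefixes matters. Choosing the image of one letter \<open>s\<close> with very large \<open>i\<close> isolates the
  occurrences of \<open>s\<close> in that maximum: for integral \<open>d\<close>, every prefix of \<open>u\<close> preceding an \<open>s\<close> is
  dominated by a prefix of \<open>v\<close> preceding an \<open>s\<close>. Scaling and rounding extend this to real \<open>d\<close>, and
  replacing \<open>-\<infinity>\<close> by a very negative number extends it to tropical entries.
\<close>

section \<open>Tropical sums and products\<close>

lemma trop_times_NegInf [simp]: "a * NegInf = NegInf"
  by (cases a) auto

text \<open>Down-sets turn the tropical sum into a union, so that maxima can be compared one real
  number at a time; \<open>NegInf\<close> fits in as the empty set.\<close>

primrec below :: "trop \<Rightarrow> real set" where
  "below NegInf = {}"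
| "below (Fin x) = {..x}"

lemma below_plus: "below (a + b) = below a \<union> below b"
  by (cases a; cases b) auto

lemma below_sum: "finite I \<Longrightarrow> below (\<Sum>i\<in>I. f i) = (\<Union>i\<in>I. below (f i))"
  by (induction rule: finite_induct) (auto simp: below_plus zero_trop_def)

lemma below_inject: "below a = below b \<longleftrightarrow> a = b"
  by (cases a; cases b) auto

lemma prod_list_Fin: "prod_list (map (\<lambda>x. Fin (f x)) xs) = Fin (sum_list (map f xs))"
  by (induction xs) (auto simp: one_trop_def)

text \<open>The value \<open>- N\<close> stands in for \<open>NegInf\<close>, so that comparisons
  over the reals apply; letting \<open>N\<close> grow recovers the tropical value.\<close>

primrec trunc :: "real \<Rightarrow> trop \<Rightarrow> real" where
  "trunc N NegInf = - N"
| "trunc N (Fin x) = x"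

lemma sum_list_trunc_Fin: "prod_list xs = Fin y \<Longrightarrow> sum_list (map (trunc N) xs) = y"
proof (induction xs arbitrary: y)
  case (Cons x xs)
  then show ?case by (cases x; cases "prod_list xs") auto
qed (auto simp: one_trop_def)

lemma sum_list_trunc_le:
  assumes "N \<ge> 0"
  shows "sum_list (map (trunc N) xs) \<le> sum_list (map (trunc 0) xs)"
  using assms by (intro sum_list_mono) (metis neg_le_0_iff_le order.refl trop.exhaust trunc.simps minus_zero)

lemma sum_list_trunc_NegInf:
  assumes "prod_list xs = NegInf" "N \<ge> 0"
  shows "sum_list (map (trunc N) xs) \<le> sum_list (map (trunc 0) xs) - N"
  using assms(1)
proof (induction xs)
  case (Cons x xs)
  then show ?case
    using sum_list_trunc_le[OF assms(2), of xs] assms(2)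
    by (cases x; cases "prod_list xs") auto
qed (auto simp: one_trop_def)

lemma le_sum_list_trunc: "r \<in> below (prod_list xs) \<Longrightarrow> r \<le> sum_list (map (trunc N) xs)"
  by (cases "prod_list xs") (auto simp: sum_list_trunc_Fin)

text \<open>A finite product does not depend on \<open>N\<close>. Otherwise some factor is
  \<open>NegInf\<close> and costs \<open>N\<close>, while the rest stays bounded above, so the sum
  falls below every real.\<close>

lemma eventually_sum_list_trunc_less:
  assumes "r \<notin> below (prod_list xs)"
  shows "\<forall>\<^sub>F N in at_top. sum_list (map (trunc N) xs) < r"
proof (cases "prod_list xs")
  case NegInf
  have "\<forall>\<^sub>F N in at_top. N > max 0 (sum_list (map (trunc 0) xs) - r)"
    by (rule eventually_gt_at_top)
  then show ?thesis
    by eventually_elim (use sum_list_trunc_NegInf[OF NegInf] in \<open>smt (verit)\<close>)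
next
  case (Fin y)
  then show ?thesis
    using assms by (auto simp: sum_list_trunc_Fin)
qed

section \<open>Morphisms into triangular matrices\<close>

lemma hom_free_semigroup_mult:
  assumes "\<phi> \<in> hom (free_semigroup \<Sigma>) S"
    and "x \<in> lists \<Sigma>" "x \<noteq> []" "y \<in> lists \<Sigma>" "y \<noteq> []"
  shows "\<phi> (x @ y) = \<phi> x \<otimes>\<^bsub>S\<^esub> \<phi> y"
  using hom_mult[OF assms(1), of x y] assms(2-) by (simp add: free_semigroup_def)

text \<open>A path from index 1 to index 2 along \<open>w\<close> switches exactly once, at some
  letter \<open>w ! t\<close>, with weights \<open>a\<close> before it and \<open>b\<close> after
  it. In the induction the new first letter gives the term \<open>t = 0\<close> and shifts the
  others by one.\<close>

lemma UT2_hom_entries: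
  assumes \<phi>: "\<phi> \<in> hom (free_semigroup \<Sigma>) UT2" and "w \<noteq> []" "w \<in> lists \<Sigma>"
  defines "a \<equiv> \<lambda>x. \<phi> [x] $ 1 $ 1" and "b \<equiv> \<lambda>x. \<phi> [x] $ 2 $ 2" and "c \<equiv> \<lambda>x. \<phi> [x] $ 1 $ 2"
  shows "\<phi> w $ 1 $ 1 = prod_list (map a w) \<and> \<phi> w $ 2 $ 2 = prod_list (map b w) \<and> \<phi> w $ 2 $ 1 = 0
    \<and> \<phi> w $ 1 $ 2 = (\<Sum>t<length w. prod_list (map a (take t w) @ c (w ! t) # map b (drop (Suc t) w)))"
  using assms(2,3)
proof (induction w rule: list_nonempty_induct)
  case (single x)
  then have "\<phi> [x] \<in> carrier UT2"
    using hom_in_carrier[OF \<phi>] by (simp add: free_semigroup_def)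
  then have "\<phi> [x] $ 2 $ 1 = 0"
    by (simp add: UT2_def zero_trop_def)
  then show ?case
    by (simp add: a_def b_def c_def)
next
  case (cons x w)
  then have "\<phi> [x] \<in> carrier UT2"
    using hom_in_carrier[OF \<phi>] by (simp add: free_semigroup_def)
  then have x: "\<phi> [x] $ 2 $ 1 = 0"
    by (simp add: UT2_def zero_trop_def)
  have "\<phi> ([x] @ w) = \<phi> [x] ** \<phi> w"
    using hom_free_semigroup_mult[OF \<phi>, of "[x]" w] cons by (simp add: UT2_def)
  then have mult: "\<phi> (x # w) $ i $ j = \<phi> [x] $ i $ 1 * \<phi> w $ 1 $ j + \<phi> [x] $ i $ 2 * \<phi> w $ 2 $ j"
    for i j by (simp add: matrix_matrix_mult_def sum_2)
  show ?case
    using cons x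
    by (simp add: mult lessThan_Suc_eq_insert_0 sum.reindex sum_distrib_left mult.assoc
        add.commute a_def b_def c_def)
qed

lemma satisfies_identity_inj_hom:
  assumes "f \<in> hom S T" "inj_on f (carrier S)"
    and "u \<in> carrier (free_semigroup \<Sigma>)" "v \<in> carrier (free_semigroup \<Sigma>)"
    and "satisfies_identity T \<Sigma> u v"
  shows "satisfies_identity S \<Sigma> u v"
  unfolding satisfies_identity_def
proof
  fix \<phi> assume \<phi>: "\<phi> \<in> hom (free_semigroup \<Sigma>) S"
  then have "f \<circ> \<phi> \<in> hom (free_semigroup \<Sigma>) T"
    using assms(1) by (rule hom_compose)
  then have "f (\<phi> u) = f (\<phi> v)"
    using assms(5) by (auto simp: satisfies_identity_def)
  then show "\<phi> u = \<phi> v"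
    using assms(2) hom_in_carrier[OF \<phi>] assms(3,4) by (auto dest: inj_onD)
qed

section \<open>The embedding of the bicyclic monoid\<close>

text \<open>The pair \<open>(i, j)\<close> stands for the normal form \<open>q^i p^j\<close>; a
  \<open>P\<close> put in front cancels against a leading \<open>Q\<close> by
  \<open>pq = 1\<close>.\<close>

fun bicyclic_nf :: "bicyclic_gen list \<Rightarrow> nat \<times> nat" where
  "bicyclic_nf [] = (0, 0)"
| "bicyclic_nf (Q # w) = (let (i, j) = bicyclic_nf w in (Suc i, j))"
| "bicyclic_nf (P # w) = (case bicyclic_nf w of (0, j) \<Rightarrow> (0, Suc j) | (Suc i, j) \<Rightarrow> (i, j))"

text \<open>In \<open>q^i p^j q^k p^l\<close> the middle cancels \<open>min j k\<close> times;
  truncated subtraction leaves the surplus of \<open>q\<close> or of \<open>p\<close>.\<close>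

fun nf_mult :: "nat \<times> nat \<Rightarrow> nat \<times> nat \<Rightarrow> nat \<times> nat" where
  "nf_mult (i, j) (k, l) = (i + (k - j), l + (j - k))"

lemma bicyclic_nf_append: "bicyclic_nf (u @ v) = nf_mult (bicyclic_nf u) (bicyclic_nf v)"
proof (induction u rule: bicyclic_nf.induct)
  case 1
  then show ?case by (cases "bicyclic_nf v") auto
next
  case (2 w)
  then show ?case by (cases "bicyclic_nf v"; cases "bicyclic_nf w") auto
next
  case (3 w)
  then show ?case
    by (cases "bicyclic_nf v"; cases "bicyclic_nf w") (auto split: nat.splits)
qed

lemma bicyclic_nf_replicate: "bicyclic_nf (replicate i Q @ replicate j P) = (i, j)"
proof (induction i)
  case 0
  show ?case by (induction j) auto
qed auto

abbreviation bicyclic_cong :: "(bicyclic_gen list \<times> bicyclic_gen list) set" where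
  "bicyclic_cong \<equiv> congruence_gen {([P, Q], [])}"

abbreviation bicyclic_class :: "bicyclic_gen list \<Rightarrow> bicyclic_gen list set" where
  "bicyclic_class w \<equiv> bicyclic_cong `` {w}"

lemma bicyclic_nf_cong: "(u, v) \<in> bicyclic_cong \<Longrightarrow> bicyclic_nf u = bicyclic_nf v"
  by (induction rule: congruence_gen.induct) (auto simp: bicyclic_nf_append)

lemma bicyclic_cong_normal_form:
  "bicyclic_nf w = (i, j) \<Longrightarrow> (w, replicate i Q @ replicate j P) \<in> bicyclic_cong"
proof (induction w arbitrary: i j rule: bicyclic_nf.induct)
  case 1
  then show ?case by (auto intro: congruence_gen.refl)
next
  case (2 w)
  obtain k l where kl: "bicyclic_nf w = (k, l)" by force
  have "([Q] @ w, [Q] @ replicate k Q @ replicate l P) \<in> bicyclic_cong"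
    by (intro congruence_gen.append congruence_gen.refl 2 kl)
  then show ?case using 2 kl by auto
next
  case (3 w)
  obtain k l where kl: "bicyclic_nf w = (k, l)" by force
  have *: "([P] @ w, [P] @ replicate k Q @ replicate l P) \<in> bicyclic_cong"
    by (intro congruence_gen.append congruence_gen.refl 3 kl)
  show ?case
  proof (cases k)
    case 0
    then show ?thesis using * 3 kl by auto
  next
    case (Suc m)
    have "([P, Q] @ replicate m Q @ replicate l P, [] @ replicate m Q @ replicate l P)
        \<in> bicyclic_cong"
      by (intro congruence_gen.append congruence_gen.refl) (auto intro: congruence_gen.base)
    then show ?thesis using * Suc 3 kl by (auto intro: congruence_gen.trans)
  qed
qed

lemma bicyclic_class_eq_iff:
  "bicyclic_class u = bicyclic_class v \<longleftrightarrow> bicyclic_nf u = bicyclic_nf v"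
proof
  assume "bicyclic_class u = bicyclic_class v"
  then have "(u, v) \<in> bicyclic_cong"
    by (simp add: eq_equiv_class_iff[OF equiv_congruence_gen])
  then show "bicyclic_nf u = bicyclic_nf v" by (rule bicyclic_nf_cong)
next
  assume eq: "bicyclic_nf u = bicyclic_nf v"
  obtain i j where "bicyclic_nf v = (i, j)" by force
  then have "(u, v) \<in> bicyclic_cong"
    using bicyclic_cong_normal_form[of u i j] bicyclic_cong_normal_form[of v i j] eq
    by (auto intro: congruence_gen.trans congruence_gen.sym)
  then show "bicyclic_class u = bicyclic_class v"
    by (rule equiv_class_eq[OF equiv_congruence_gen])
qed

lemma carrier_bicyclic: "carrier bicyclic = range bicyclic_class"
  by (auto simp: bicyclic_def presented_monoid_def quotient_def)

lemma bicyclic_mult_class: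
  "bicyclic_class x \<otimes>\<^bsub>bicyclic\<^esub> bicyclic_class y = bicyclic_class (x @ y)"
  unfolding bicyclic_def by (rule presented_monoid_mult_class)

definition nf_matrix :: "nat \<times> nat \<Rightarrow> trop ^ 2 ^ 2" where
  "nf_matrix p = (\<chi> i j. if i = 1 then if j = 1 then Fin (real (fst p) - real (snd p)) else Fin (fst p)
     else if j = 1 then NegInf else Fin 0)"

definition bicyclic_matrix :: "bicyclic_gen list set \<Rightarrow> trop ^ 2 ^ 2" where
  "bicyclic_matrix X = nf_matrix (the_elem (bicyclic_nf ` X))"

lemma bicyclic_matrix_class: "bicyclic_matrix (bicyclic_class w) = nf_matrix (bicyclic_nf w)"
proof -
  have "bicyclic_nf ` bicyclic_class w = {bicyclic_nf w}"
    using bicyclic_nf_cong congruence_gen.refl by fastforce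
  then show ?thesis by (simp add: bicyclic_matrix_def)
qed

text \<open>For \<open>p = (i, j)\<close> and \<open>q = (k, l)\<close> the (1,2) entry of the
  product is \<open>max (i - j + k) i\<close>, that is, \<open>i\<close> plus the truncated
  difference of \<open>k\<close> and \<open>j\<close>.\<close>

lemma nf_matrix_mult: "nf_matrix (nf_mult p q) = nf_matrix p ** nf_matrix q"
  by (cases p; cases q)
    (auto simp: nf_matrix_def matrix_matrix_mult_def vec_eq_iff sum_2 forall_2 of_nat_diff max_def
      split: nat_diff_split)

lemma inj_nf_matrix: "inj nf_matrix"
proof
  fix p q :: "nat \<times> nat"
  assume eq: "nf_matrix p = nf_matrix q"
  have "nf_matrix p $ 1 $ j = nf_matrix q $ 1 $ j" for j by (simp add: eq)
  from this[of 1] this[of 2] show "p = q"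
    by (simp add: nf_matrix_def prod_eq_iff)
qed

lemma bicyclic_matrix_hom: "bicyclic_matrix \<in> hom bicyclic UT2"
proof (rule homI)
  fix X assume "X \<in> carrier bicyclic"
  then show "bicyclic_matrix X \<in> carrier UT2"
    by (auto simp: carrier_bicyclic bicyclic_matrix_class UT2_def nf_matrix_def)
next
  fix X Y assume "X \<in> carrier bicyclic" "Y \<in> carrier bicyclic"
  then show "bicyclic_matrix (X \<otimes>\<^bsub>bicyclic\<^esub> Y) = bicyclic_matrix X \<otimes>\<^bsub>UT2\<^esub> bicyclic_matrix Y"
    by (auto simp: carrier_bicyclic bicyclic_mult_class bicyclic_matrix_class
        bicyclic_nf_append nf_matrix_mult UT2_def)
qed

lemma bicyclic_matrix_inj: "inj_on bicyclic_matrix (carrier bicyclic)"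
  unfolding carrier_bicyclic
proof (rule inj_onI, elim rangeE)
  fix X Y u v
  assume "bicyclic_matrix X = bicyclic_matrix Y" and X: "X = bicyclic_class u" "Y = bicyclic_class v"
  then have "bicyclic_nf u = bicyclic_nf v"
    by (simp add: bicyclic_matrix_class inj_eq[OF inj_nf_matrix])
  then show "X = Y"
    unfolding X by (simp only: bicyclic_class_eq_iff)
qed

section \<open>Identities of the bicyclic monoid\<close>

lemma hom_concat_bicyclic:
  "(\<lambda>w. bicyclic_class (concat (map g w))) \<in> hom (free_semigroup \<Sigma>) bicyclic"
  by (rule homI) (auto simp: carrier_bicyclic free_semigroup_def bicyclic_mult_class)

locale bicyclic_identity =
  fixes \<Sigma> :: "'x set" and u v :: "'x list"
  assumes u: "u \<in> lists \<Sigma>" "u \<noteq> []" and v: "v \<in> lists \<Sigma>" "v \<noteq> []"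
    and identity: "satisfies_identity bicyclic \<Sigma> u v"
begin

text \<open>Each letter \<open>x\<close> goes to \<open>q^(i x) p^(j x)\<close>, whose matrix has
  (2,2) entry 0. Suffixes then contribute nothing, and the (1,1) and (1,2) entries give the two
  equations.\<close>

lemma weights_eq:
  fixes i j :: "'x \<Rightarrow> nat"
  defines "d \<equiv> \<lambda>x. real (i x) - real (j x)"
  shows "sum_list (map d u) = sum_list (map d v)"
    and "(\<Union>t<length u. {..sum_list (map d (take t u)) + i (u ! t)})
      = (\<Union>t<length v. {..sum_list (map d (take t v)) + i (v ! t)})"
proof -
  define g where "g x = replicate (i x) Q @ replicate (j x) P" for x
  define \<phi> where "\<phi> w = bicyclic_class (concat (map g w))" for w
  have "\<phi> \<in> hom (free_semigroup \<Sigma>) bicyclic"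
    unfolding \<phi>_def by (rule hom_concat_bicyclic)
  then have hom: "bicyclic_matrix \<circ> \<phi> \<in> hom (free_semigroup \<Sigma>) UT2" and "\<phi> u = \<phi> v"
    using identity bicyclic_matrix_hom by (auto simp: satisfies_identity_def intro: hom_compose)
  then have eq: "(bicyclic_matrix \<circ> \<phi>) u = (bicyclic_matrix \<circ> \<phi>) v" by simp
  have letter: "(bicyclic_matrix \<circ> \<phi>) [x] = nf_matrix (i x, j x)" for x
    by (simp add: \<phi>_def g_def bicyclic_matrix_class bicyclic_nf_replicate)
  have 11: "nf_matrix (i x, j x) $ 1 $ 1 = Fin (d x)"
    and 12: "nf_matrix (i x, j x) $ 1 $ 2 = Fin (i x)"
    and 22: "nf_matrix (i x, j x) $ 2 $ 2 = Fin 0" for x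
    by (simp_all add: nf_matrix_def d_def)
  note entries = UT2_hom_entries[OF hom, unfolded letter 11 12 22]
  show "sum_list (map d u) = sum_list (map d v)"
    using entries[OF u(2,1)] entries[OF v(2,1)] eq by (simp add: prod_list_Fin)
  have below_term: "below (prod_list (map (\<lambda>x. Fin (d x)) y @ Fin e # map (\<lambda>x. Fin 0) z))
      = {..sum_list (map d y) + e}" for y z :: "'x list" and e :: real
    by (simp add: prod_list_Fin)
  have below_12: "below ((bicyclic_matrix \<circ> \<phi>) w $ 1 $ 2)
      = (\<Union>t<length w. {..sum_list (map d (take t w)) + i (w ! t)})" if "w \<in> lists \<Sigma>" "w \<noteq> []" for w
    using entries[OF that(2,1)] by (simp only: below_sum finite_lessThan below_term)
  show "(\<Union>t<length u. {..sum_list (map d (take t u)) + i (u ! t)})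
      = (\<Union>t<length v. {..sum_list (map d (take t v)) + i (v ! t)})"
    using below_12[OF u] below_12[OF v] eq by simp
qed

text \<open>Weight 1 on a single letter and 0 elsewhere counts its occurrences.\<close>

lemma mset_eq: "mset u = mset v"
proof (rule multiset_eqI)
  fix x :: 'x
  have "sum_list (map (\<lambda>y. real (if y = x then 1 else 0) - real 0) w) = count (mset w) x" for w
    by (induction w) auto
  from this[of u] this[of v] show "count (mset u) x = count (mset v) x"
    using weights_eq(1)[of "\<lambda>y. if y = x then 1 else 0" "\<lambda>_. 0"] by simp
qed

lemma int_dominated:
  fixes d :: "'x \<Rightarrow> int"
  assumes t: "t < length u"
  shows "\<exists>r<length v. v ! r = u ! t \<and> sum_list (map d (take t u)) \<le> sum_list (map d (take r v))"
proof -
  define s where "s = u ! t"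
  define K where "K = sum_list (map (\<lambda>x. \<bar>d x\<bar>) u)"
  \<comment> \<open>The sum depends only on the multiset of letters, so the same \<open>K\<close>
    bounds the prefixes of both words.\<close>
  have K: "K = sum_list (map (\<lambda>x. \<bar>d x\<bar>) v)"
    unfolding K_def by (metis mset_eq mset_map sum_mset_sum_list)
  have bound: "\<bar>sum_list (map d (take r w))\<bar> + \<bar>d (w ! r)\<bar> \<le> sum_list (map (\<lambda>x. \<bar>d x\<bar>) w)"
    if "r < length w" for w r
  proof -
    have "\<bar>sum_list (map d (take r w))\<bar> \<le> sum_list (map (\<lambda>x. \<bar>d x\<bar>) (take r w))"
      using sum_list_abs[of "map d (take r w)"] by (simp add: o_def)
    moreover have "0 \<le> sum_list (map (\<lambda>x. \<bar>d x\<bar>) (drop (Suc r) w))"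
      by (rule sum_list_nonneg) auto
    moreover have "sum_list (map (\<lambda>x. \<bar>d x\<bar>) w) = sum_list (map (\<lambda>x. \<bar>d x\<bar>) (take r w @ w ! r # drop (Suc r) w))"
      using id_take_nth_drop[OF that] by simp
    ultimately show ?thesis by simp
  qed
  \<comment> \<open>An occurrence of \<open>s\<close> has value at least
    \<open>- K + (2 * K + 1) = K + 1\<close>, while positions with other letters stay at most
    \<open>K\<close>. Off \<open>s\<close>, \<open>nat (d x)\<close> is the least choice that keeps
    \<open>i x - d x\<close> nonnegative.\<close>
  define i where "i x = (if x = s then nat (2 * K + 1) else nat (d x))" for x
  define j where "j x = nat (int (i x) - d x)" for x
  have "d s \<le> 2 * K + 1"
    using bound[OF t] by (simp flip: s_def K_def)
  then have "real (i x) - real (j x) = real_of_int (d x)" for x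
    by (auto simp: j_def i_def)
  then have weight: "sum_list (map (\<lambda>x. real (i x) - real (j x)) w) = of_int (sum_list (map d w))" for w
    by (induction w) auto
  have "of_int (sum_list (map d (take t u)) + i (u ! t))
      \<in> (\<Union>r<length v. {..real_of_int (sum_list (map d (take r v)) + i (v ! r))})"
    using weights_eq(2)[of i j] t by (auto simp: weight)
  then obtain r where r: "r < length v"
    and le: "sum_list (map d (take t u)) + i (u ! t) \<le> sum_list (map d (take r v)) + i (v ! r)"
    by (simp only: UN_iff lessThan_iff atMost_iff of_int_le_iff) blast
  have "v ! r = s"
  proof (rule ccontr)
    assume "v ! r \<noteq> s"
    then have "int (i (v ! r)) \<le> \<bar>d (v ! r)\<bar>" and "2 * K + 1 \<le> int (i (u ! t))"
      by (simp_all add: i_def s_def)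
    then show False
      using bound[OF t] bound[OF r] le K unfolding K_def by linarith
  qed
  then show ?thesis
    using r le by (intro exI[of _ r]) (simp add: s_def)
qed

text \<open>Scaling by \<open>n\<close> enlarges a positive gap without bound, whereas rounding down
  costs at most 1 per letter; so a failure for \<open>d\<close> would give one for integral
  weights.\<close>

lemma real_dominated:
  fixes d :: "'x \<Rightarrow> real"
  assumes t: "t < length u"
  shows "\<exists>r<length v. v ! r = u ! t \<and> sum_list (map d (take t u)) \<le> sum_list (map d (take r v))"
proof (rule ccontr)
  assume neg: "\<not> ?thesis"
  define \<delta> where "\<delta> r = sum_list (map d (take t u)) - sum_list (map d (take r v))" for r
  have "\<forall>\<^sub>F n in sequentially. real (length u) < real n * \<delta> r"
    if "r \<in> {r. r < length v \<and> v ! r = u ! t}" for r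
  proof -
    have "\<delta> r > 0" using neg that by (auto simp: \<delta>_def)
    moreover have "\<forall>\<^sub>F n in sequentially. real n > length u / \<delta> r"
      using filterlim_real_sequentially by (auto simp: filterlim_at_top_dense)
    ultimately show ?thesis
      by (auto elim!: eventually_mono simp: field_simps)
  qed
  \<comment> \<open>Only finitely many positions compete, so a single \<open>n\<close> lifts all
    their gaps above \<open>length u\<close>, a bound for the rounding error.\<close>
  then have "\<forall>\<^sub>F n in sequentially. \<forall>r\<in>{r. r < length v \<and> v ! r = u ! t}.
      real (length u) < real n * \<delta> r"
    by (intro eventually_ball_finite) auto
  then obtain n :: nat where n: "\<And>r. r < length v \<Longrightarrow> v ! r = u ! t \<Longrightarrow> real (length u) < real n * \<delta> r"
    by (auto simp: eventually_sequentially)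
  define e where "e x = \<lfloor>real n * d x\<rfloor>" for x
  have e: "of_int (sum_list (map e w)) \<le> real n * sum_list (map d w)"
    "real n * sum_list (map d w) \<le> of_int (sum_list (map e w)) + length w" for w
  proof (induction w)
    case (Cons x w)
    have "of_int (e x) \<le> real n * d x" "real n * d x \<le> of_int (e x) + 1"
      unfolding e_def by linarith+
    with Cons show "of_int (sum_list (map e (x # w))) \<le> real n * sum_list (map d (x # w))"
      "real n * sum_list (map d (x # w)) \<le> of_int (sum_list (map e (x # w))) + length (x # w)"
      by (auto simp: distrib_left)
  qed auto
  obtain r where r: "r < length v" "v ! r = u ! t"
    and le: "sum_list (map e (take t u)) \<le> sum_list (map e (take r v))"
    using int_dominated[OF t, of e] by blast
  have "real n * sum_list (map d (take t u)) \<le> of_int (sum_list (map e (take t u))) + length u"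
    using e(2)[of "take t u"] t by simp
  also have "\<dots> \<le> of_int (sum_list (map e (take r v))) + length u"
    using le by simp
  also have "\<dots> \<le> real n * sum_list (map d (take r v)) + length u"
    using e(1)[of "take r v"] by simp
  finally show False
    using n[OF r] by (simp add: \<delta>_def right_diff_distrib)
qed

text \<open>If no position of \<open>v\<close> reached \<open>x\<close>, one \<open>N\<close> would
  push all the finitely many truncated terms of \<open>v\<close> below \<open>x\<close>, against the
  real case for this \<open>N\<close>.\<close>

lemma trop_dominated:
  fixes a b c :: "'x \<Rightarrow> trop"
  defines "trm \<equiv> \<lambda>w t. map a (take t w) @ c (w ! t) # map b (drop (Suc t) w)"
  assumes t: "t < length u" and x: "x \<in> below (prod_list (trm u t))"
  shows "\<exists>r<length v. x \<in> below (prod_list (trm v r))"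
proof (rule ccontr)
  assume "\<not> ?thesis"
  then have "\<forall>r\<in>{..<length v}. \<forall>\<^sub>F N in at_top. sum_list (map (trunc N) (trm v r)) < x"
    using eventually_sum_list_trunc_less by blast
  then have "\<forall>\<^sub>F N in at_top. \<forall>r\<in>{..<length v}. sum_list (map (trunc N) (trm v r)) < x"
    by (intro eventually_ball_finite) auto
  then obtain N where N: "\<And>r. r < length v \<Longrightarrow> sum_list (map (trunc N) (trm v r)) < x"
    by (auto simp: eventually_at_top_linorder)
  define d where "d y = trunc N (a y) - trunc N (b y)" for y
  \<comment> \<open>The \<open>b\<close>-weight of the suffix is that of the whole word minus those
    of the prefix and of the letter \<open>w ! r\<close>.\<close>
  have expand: "sum_list (map (trunc N) (trm w r)) = sum_list (map d (take r w))
      + sum_list (map (\<lambda>y. trunc N (b y)) w) + trunc N (c (w ! r)) - trunc N (b (w ! r))"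
    if "r < length w" for w r
  proof -
    have "sum_list (map (\<lambda>y. trunc N (b y)) w)
        = sum_list (map (\<lambda>y. trunc N (b y)) (take r w @ w ! r # drop (Suc r) w))"
      using id_take_nth_drop[OF that] by simp
    then show ?thesis
      by (simp add: trm_def d_def[abs_def] o_def sum_list_subtractf)
  qed
  have total: "sum_list (map (\<lambda>y. trunc N (b y)) u) = sum_list (map (\<lambda>y. trunc N (b y)) v)"
    by (metis mset_eq mset_map sum_mset_sum_list)
  obtain r where r: "r < length v" "v ! r = u ! t"
    and le: "sum_list (map d (take t u)) \<le> sum_list (map d (take r v))"
    using real_dominated[OF t] by blast
  have "x \<le> sum_list (map (trunc N) (trm u t))"
    using x by (rule le_sum_list_trunc)
  \<comment> \<open>As the letters at \<open>t\<close> and \<open>r\<close> agree, the corrections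
    by \<open>b\<close> and \<open>c\<close> coincide.\<close>
  also have "\<dots> \<le> sum_list (map (trunc N) (trm v r))"
    using le total r by (simp add: expand[OF t] expand[OF r(1)])
  finally show False
    using N[OF r(1)] by simp
qed

end

text \<open>The hypothesis is symmetric in \<open>u\<close> and \<open>v\<close>, so domination in
  both directions equates the (1,2) entries. The diagonal entries are commutative products and
  depend only on the multiset of letters.\<close>

lemma bicyclic_identity_imp_UT2:
  assumes "bicyclic_identity \<Sigma> u v"
  shows "satisfies_identity UT2 \<Sigma> u v"
  unfolding satisfies_identity_def
proof
  interpret uv: bicyclic_identity \<Sigma> u v by fact
  interpret vu: bicyclic_identity \<Sigma> v u
    using uv.u uv.v uv.identity by unfold_locales (auto simp: satisfies_identity_def)
  fix \<phi> assume \<phi>: "\<phi> \<in> hom (free_semigroup \<Sigma>) UT2"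
  note U = UT2_hom_entries[OF \<phi> uv.u(2,1)] and V = UT2_hom_entries[OF \<phi> uv.v(2,1)]
  note u12 = U[THEN conjunct2, THEN conjunct2, THEN conjunct2]
    and v12 = V[THEN conjunct2, THEN conjunct2, THEN conjunct2]
  have prod: "prod_list (map f u) = prod_list (map f v)" for f :: "_ \<Rightarrow> trop"
    by (metis uv.mset_eq mset_map prod_mset_prod_list)
  have "below (\<phi> u $ 1 $ 2) = below (\<phi> v $ 1 $ 2)"
  proof (intro equalityI subsetI)
    fix x assume "x \<in> below (\<phi> u $ 1 $ 2)"
    then show "x \<in> below (\<phi> v $ 1 $ 2)"
      unfolding u12 v12 below_sum[OF finite_lessThan] UN_iff
      using uv.trop_dominated by (meson lessThan_iff)
  next
    fix x assume "x \<in> below (\<phi> v $ 1 $ 2)"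
    then show "x \<in> below (\<phi> u $ 1 $ 2)"
      unfolding u12 v12 below_sum[OF finite_lessThan] UN_iff
      using vu.trop_dominated by (meson lessThan_iff)
  qed
  then have "\<phi> u $ 1 $ 2 = \<phi> v $ 1 $ 2"
    by (simp add: below_inject)
  then show "\<phi> u = \<phi> v"
    using U V by (simp add: vec_eq_iff forall_2 prod)
qed

theorem theorem4p1:
  fixes \<Sigma> :: "'x set" and u v :: "'x list"
  assumes "finite \<Sigma>"
    and "u \<in> carrier (free_semigroup \<Sigma>)" and "v \<in> carrier (free_semigroup \<Sigma>)"
  shows "satisfies_identity bicyclic \<Sigma> u v \<longleftrightarrow> satisfies_identity UT2 \<Sigma> u v"
proof
  assume "satisfies_identity bicyclic \<Sigma> u v"
  then have "bicyclic_identity \<Sigma> u v"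
    using assms(2,3) by unfold_locales (auto simp: free_semigroup_def)
  then show "satisfies_identity UT2 \<Sigma> u v"
    by (rule bicyclic_identity_imp_UT2)
next
  assume "satisfies_identity UT2 \<Sigma> u v"
  with bicyclic_matrix_hom bicyclic_matrix_inj assms(2,3)
  show "satisfies_identity bicyclic \<Sigma> u v"
    by (rule satisfies_identity_inj_hom)
qed

end
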